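(* Let $A$ and $B$ be bounded positive operators on a complex Hilbert space $\mathscr{H}$. Then there is a decomposition of $A$ with respect to $B$ into $B$-absolutely continuous and $B$-singular parts, namely $$A=A_{\ll,B}+A_{\perp,B},$$ where $A_{\ll,B}$ and $A_{\perp,B}$ are bounded positive operators, $A_{\ll,B}$ is $B$-absolutely continuous and $A_{\perp,B}$ and $B$ are singular. The decomposition of $A$ into a sum of a $B$-absolutely continuous and a $B$-singular bounded positive operator is unique if and only if $A_{\ll,B}$ is dominated by $B$.
   Context: $\mathscr{H}$ is a complex Hilbert space with inner product $(\cdot\,|\,\cdot)$ and $\mathbf{B}_+(\mathscr{H})$ is the set of bounded positive operators on $\mathscr{H}$, with $A\leq B$ iff $(Ax\,|\,x)\leq(Bx\,|\,x)$ for all $x$. $A$ is dominated by $B$ if $A\leq cB$ for some constant $c$. $A$ is $B$-absolutely continuous ($A\ll B$) if $Bx=0$ implies $Ax=0$, i.e. $\ker B\subseteq\ker A$. $A$ and $B$ are singular ($A\perp B$; $A$ is $B$-singular) if $0$ is the only positive operator dominated by both $A$ and $B$ (equivalently, $\operatorname{ran}A^{1/2}\cap\operatorname{ran}B^{1/2}=\{0\}$). For $A,B\in\mathbf{B}_+(\mathscr{H})$, $A_{\ll,B}\in\mathbf{B}_+(\mathscr{H})$ is the operator corresponding to the bounded nonnegative sesquilinear form whose quadratic form is $x\mapsto\inf_{y\in\ker B}(A(x-y)\,|\,x-y)$, i.e. $(A_{\ll,B}x\,|\,x)$ equals this infimum for all $x\in\mathscr{H}$; and $A_{\perp,B}:=A-A_{\ll,B}$.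 *)

theory Defs
  imports "HOL-Analysis.Analysis" "HOL-Library.Complex_Order"
begin

section \<open>Complex Hilbert spaces\<close>

text \<open>The inner product is linear in its first argument. The real vector space and norm structure
  of the underlying class is tied to the complex one by \<open>scaleR_scaleC\<close> and \<open>cinner_self\<close>.\<close>

class complex_inner = real_normed_vector +
  fixes scaleC :: "complex \<Rightarrow> 'a \<Rightarrow> 'a"  (infixr \<open>*\<^sub>C\<close> 75)
    and cinner :: "'a \<Rightarrow> 'a \<Rightarrow> complex"
  assumes scaleC_add_right: "c *\<^sub>C (x + y) = c *\<^sub>C x + c *\<^sub>C y"
    and scaleC_add_left: "(c + d) *\<^sub>C x = c *\<^sub>C x + d *\<^sub>C x"
    and scaleC_scaleC: "c *\<^sub>C d *\<^sub>C x = (c * d) *\<^sub>C x"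
    and scaleR_scaleC: "r *\<^sub>R x = complex_of_real r *\<^sub>C x"
    and cinner_commute: "cinner x y = cnj (cinner y x)"
    and cinner_add_left: "cinner (x + y) z = cinner x z + cinner y z"
    and cinner_scaleC_left: "cinner (c *\<^sub>C x) y = c * cinner x y"
    and cinner_self: "cinner x x = complex_of_real ((norm x)\<^sup>2)"

class chilbert_space = complex_inner + complete_space

section \<open>Bounded positive operators\<close>

definition bounded_clinear :: "('a::complex_inner \<Rightarrow> 'a) \<Rightarrow> bool" where
  "bounded_clinear A \<longleftrightarrow> bounded_linear A \<and> (\<forall>c x. A (c *\<^sub>C x) = c *\<^sub>C A x)"

text \<open>The order on \<^typ>\<open>complex\<close> is the one under which \<open>0 \<le> z\<close> means that \<open>z\<close> is real and
  nonnegative.\<close>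

definition bounded_positive :: "('a::complex_inner \<Rightarrow> 'a) \<Rightarrow> bool" where
  "bounded_positive A \<longleftrightarrow> bounded_clinear A \<and> (\<forall>x. 0 \<le> cinner (A x) x)"

definition op_le :: "('a::complex_inner \<Rightarrow> 'a) \<Rightarrow> ('a \<Rightarrow> 'a) \<Rightarrow> bool" where
  "op_le A B \<longleftrightarrow> (\<forall>x. cinner (A x) x \<le> cinner (B x) x)"

definition dominated :: "('a::complex_inner \<Rightarrow> 'a) \<Rightarrow> ('a \<Rightarrow> 'a) \<Rightarrow> bool" where
  "dominated A B \<longleftrightarrow> (\<exists>c::real. op_le A (\<lambda>x. c *\<^sub>R B x))"

definition op_kernel :: "('a::complex_inner \<Rightarrow> 'a) \<Rightarrow> 'a set" where
  "op_kernel A = {x. A x = 0}"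

definition abs_cont :: "('a::complex_inner \<Rightarrow> 'a) \<Rightarrow> ('a \<Rightarrow> 'a) \<Rightarrow> bool" where
  "abs_cont A B \<longleftrightarrow> op_kernel B \<subseteq> op_kernel A"

definition singular :: "('a::complex_inner \<Rightarrow> 'a) \<Rightarrow> ('a \<Rightarrow> 'a) \<Rightarrow> bool" where
  "singular A B \<longleftrightarrow>
     (\<forall>C. bounded_positive C \<longrightarrow> dominated C A \<longrightarrow> dominated C B \<longrightarrow> C = (\<lambda>x. 0))"

section \<open>The two parts of an operator\<close>

definition ac_quadratic_form :: "('a::complex_inner \<Rightarrow> 'a) \<Rightarrow> ('a \<Rightarrow> 'a) \<Rightarrow> 'a \<Rightarrow> real" where
  "ac_quadratic_form A B x = (INF y\<in>op_kernel B. Re (cinner (A (x - y)) (x - y)))"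

text \<open>Existence and uniqueness of the operator described below are proved in \<open>ex1_ac_part\<close>.\<close>

definition ac_part :: "('a::complex_inner \<Rightarrow> 'a) \<Rightarrow> ('a \<Rightarrow> 'a) \<Rightarrow> 'a \<Rightarrow> 'a" where
  "ac_part A B = (THE C. bounded_positive C \<and>
     (\<forall>x. cinner (C x) x = complex_of_real (ac_quadratic_form A B x)))"

definition sing_part :: "('a::complex_inner \<Rightarrow> 'a) \<Rightarrow> ('a \<Rightarrow> 'a) \<Rightarrow> 'a \<Rightarrow> 'a" where
  "sing_part A B = (\<lambda>x. A x - ac_part A B x)"

definition lebesgue_decomposition ::
    "('a::complex_inner \<Rightarrow> 'a) \<Rightarrow> ('a \<Rightarrow> 'a) \<Rightarrow> ('a \<Rightarrow> 'a) \<Rightarrow> ('a \<Rightarrow> 'a) \<Rightarrow> bool" where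
  "lebesgue_decomposition A B C S \<longleftrightarrow>
     A = (\<lambda>x. C x + S x) \<and> bounded_positive C \<and> bounded_positive S \<and>
     abs_cont C B \<and> singular S B"

section \<open>Well-definedness of the absolutely continuous part\<close>

subsection \<open>Sesquilinearity\<close>

lemma cinner_add_right: "cinner x (y + z) = cinner x y + cinner x (z::'a::complex_inner)"
  by (metis cinner_commute cinner_add_left complex_cnj_add)

lemma cinner_scaleC_right: "cinner x (c *\<^sub>C y) = cnj c * cinner x (y::'a::complex_inner)"
  by (metis cinner_commute cinner_scaleC_left complex_cnj_mult)

lemma cinner_scaleR_left: "cinner (r *\<^sub>R x) y = of_real r * cinner x (y::'a::complex_inner)"
  by (simp add: scaleR_scaleC cinner_scaleC_left)

lemma cinner_scaleR_right: "cinner x (r *\<^sub>R y) = of_real r * cinner x (y::'a::complex_inner)"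
  by (simp add: scaleR_scaleC cinner_scaleC_right)

lemma cinner_minus_left: "cinner (- x) y = - cinner x (y::'a::complex_inner)"
  using cinner_scaleR_left[of "-1" x y] by simp

lemma cinner_minus_right: "cinner x (- y) = - cinner x (y::'a::complex_inner)"
  using cinner_scaleR_right[of x "-1" y] by simp

lemma cinner_diff_left: "cinner (x - y) z = cinner x z - cinner y (z::'a::complex_inner)"
  using cinner_add_left[of x "-y" z] by (simp add: cinner_minus_left)

lemma cinner_diff_right: "cinner x (y - z) = cinner x y - cinner x (z::'a::complex_inner)"
  using cinner_add_right[of x y "-z"] by (simp add: cinner_minus_right)

lemma cinner_zero_left [simp]: "cinner 0 (y::'a::complex_inner) = 0"
  using cinner_diff_left[of 0 0 y] by simp

lemma cinner_zero_right [simp]: "cinner (y::'a::complex_inner) 0 = 0"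
  using cinner_diff_right[of y 0 0] by simp

lemma scaleC_one: "1 *\<^sub>C x = (x::'a::complex_inner)"
  using scaleR_scaleC[of 1 x] by simp

lemma scaleC_diff_right: "c *\<^sub>C (x - y) = c *\<^sub>C x - c *\<^sub>C (y::'a::complex_inner)"
  using scaleC_add_right[of c "x - y" y] by (simp add: algebra_simps)

lemma scaleC_zero_right [simp]: "c *\<^sub>C (0::'a::complex_inner) = 0"
  using scaleC_diff_right[of c 0 0] by simp

lemma norm_scaleC: "norm (c *\<^sub>C x) = norm c * norm (x::'a::complex_inner)"
proof -
  have "complex_of_real ((norm (c *\<^sub>C x))\<^sup>2) = c * cnj c * complex_of_real ((norm x)\<^sup>2)"
    unfolding cinner_self[symmetric] by (simp add: cinner_scaleC_left cinner_scaleC_right)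
  also have "\<dots> = complex_of_real ((norm c * norm x)\<^sup>2)"
    using complex_norm_square[of c] by (simp add: power_mult_distrib)
  finally have "(norm (c *\<^sub>C x))\<^sup>2 = (norm c * norm x)\<^sup>2"
    using of_real_eq_iff by blast
  then show ?thesis by simp
qed

subsection \<open>Positive operators\<close>

lemma discriminant_bound:
  fixes d r q :: real
  assumes "\<And>t. 0 \<le> d - 2 * t * r + t\<^sup>2 * q" "0 \<le> q"
  shows "\<bar>r\<bar> \<le> sqrt d * sqrt q"
proof (cases "q = 0")
  case True
  have "r = 0"
  proof (rule ccontr)
    assume "r \<noteq> 0"
    with assms(1)[of "(d + 1) / (2 * r)"] True show False by simp
  qed
  with True show ?thesis by simp
next
  case False
  have "0 \<le> d - 2 * (r / q) * r + (r / q)\<^sup>2 * q" by (rule assms(1))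
  also have "\<dots> = d - r\<^sup>2 / q" using False by (simp add: field_simps power2_eq_square)
  finally have "r\<^sup>2 \<le> d * q" using False assms(2) by (simp add: field_simps)
  then have "sqrt (r\<^sup>2) \<le> sqrt (d * q)" by (rule real_sqrt_le_mono)
  then show ?thesis by (simp add: real_sqrt_mult)
qed

context
  fixes A :: "'a::complex_inner \<Rightarrow> 'a"
  assumes A: "bounded_positive A"
begin

lemma pos_bl: "bounded_linear A"
  using A by (simp add: bounded_positive_def bounded_clinear_def)

lemma pos_add: "A (x + y) = A x + A y"
  by (rule linear_add[OF bounded_linear.linear[OF pos_bl]])

lemma pos_diff: "A (x - y) = A x - A y"
  by (rule linear_diff[OF bounded_linear.linear[OF pos_bl]])

lemma pos_scaleR: "A (r *\<^sub>R x) = r *\<^sub>R A x"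
  by (rule linear_scale[OF bounded_linear.linear[OF pos_bl]])

lemma pos_zero: "A 0 = 0"
  by (rule linear_0[OF bounded_linear.linear[OF pos_bl]])

lemma pos_scaleC: "A (c *\<^sub>C x) = c *\<^sub>C A x"
  using A by (simp add: bounded_positive_def bounded_clinear_def)

lemma pos_Re: "0 \<le> Re (cinner (A x) x)"
  using A by (simp add: bounded_positive_def less_eq_complex_def)

lemma pos_Im: "Im (cinner (A x) x) = 0"
  using A by (simp add: bounded_positive_def less_eq_complex_def)

lemma pos_sym: "Re (cinner (A x) y) = Re (cinner (A y) x)"
  using pos_Im[of "x + \<i> *\<^sub>C y"] pos_Im[of x] pos_Im[of y]
  by (simp add: pos_add pos_scaleC cinner_add_left cinner_add_right cinner_scaleC_left
      cinner_scaleC_right)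

lemma pos_expand:
  "Re (cinner (A (u - t *\<^sub>R w)) (u - t *\<^sub>R w))
     = Re (cinner (A u) u) - 2 * t * Re (cinner (A u) w) + t\<^sup>2 * Re (cinner (A w) w)"
  by (simp add: pos_diff pos_scaleR cinner_diff_left cinner_diff_right cinner_scaleR_left
      cinner_scaleR_right pos_sym[of w u] algebra_simps power2_eq_square)

lemma pos_Cauchy_Schwarz:
  "\<bar>Re (cinner (A x) y)\<bar> \<le> sqrt (Re (cinner (A x) x)) * sqrt (Re (cinner (A y) y))"
  by (rule discriminant_bound) (simp_all add: pos_Re flip: pos_expand)

lemma pos_seminorm_add:
  "sqrt (Re (cinner (A (x + y)) (x + y)))
     \<le> sqrt (Re (cinner (A x) x)) + sqrt (Re (cinner (A y) y))"
proof (rule real_le_lsqrt)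
  show "Re (cinner (A (x + y)) (x + y))
     \<le> (sqrt (Re (cinner (A x) x)) + sqrt (Re (cinner (A y) y)))\<^sup>2"
    using pos_Cauchy_Schwarz[of x y]
    by (simp add: pos_add cinner_add_left cinner_add_right pos_sym[of y x] power2_sum pos_Re)
qed (simp_all add: pos_Re)

lemma pos_seminorm_scaleC:
  "sqrt (Re (cinner (A (c *\<^sub>C x)) (c *\<^sub>C x))) = norm c * sqrt (Re (cinner (A x) x))"
proof -
  have "cinner (A (c *\<^sub>C x)) (c *\<^sub>C x) = of_real ((norm c)\<^sup>2) * cinner (A x) x"
    using complex_norm_square[of c] by (simp add: pos_scaleC cinner_scaleC_left cinner_scaleC_right mult.assoc[symmetric] mult.commute[of "cnj c" c])
  then have "Re (cinner (A (c *\<^sub>C x)) (c *\<^sub>C x)) = (norm c)\<^sup>2 * Re (cinner (A x) x)"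
    by (simp only: Re_complex_of_real Im_complex_of_real times_complex.sel mult_zero_left diff_zero)
  then show ?thesis by (simp add: real_sqrt_mult)
qed

end

lemma cinner_Cauchy_Schwarz_Re: "\<bar>Re (cinner x y)\<bar> \<le> norm x * norm (y::'a::complex_inner)"
proof -
  have "bounded_positive (\<lambda>x::'a. x)"
    by (auto simp: bounded_positive_def bounded_clinear_def cinner_self less_eq_complex_def)
  from pos_Cauchy_Schwarz[OF this, of x y] show ?thesis by (simp add: cinner_self)
qed

lemma norm_le_Re_plus: "norm z \<le> \<bar>Re z\<bar> + \<bar>Re (\<i> * z)\<bar>"
  using cmod_le[of z] by simp

lemma cinner_bound: "norm (cinner x y) \<le> 2 * (norm x * norm (y::'a::complex_inner))"
  using norm_le_Re_plus[of "cinner x y"] cinner_Cauchy_Schwarz_Re[of x y]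
    cinner_Cauchy_Schwarz_Re[of "\<i> *\<^sub>C x" y]
  by (simp add: cinner_scaleC_left norm_scaleC)

lemma pos_norm_bound:
  assumes A: "bounded_positive (A :: 'a::complex_inner \<Rightarrow> 'a)"
  obtains M where "0 \<le> M" "\<And>x. norm (A x) \<le> M * sqrt (Re (cinner (A x) x))"
    "\<And>x. sqrt (Re (cinner (A x) x)) \<le> M * norm x"
proof -
  obtain K where K: "K > 0" "\<And>x. norm (A x) \<le> norm x * K"
    using bounded_linear.pos_bounded[OF pos_bl[OF A]] by blast
  have q: "sqrt (Re (cinner (A x) x)) \<le> sqrt K * norm x" for x
  proof -
    have "Re (cinner (A x) x) \<le> norm (A x) * norm x"
      using cinner_Cauchy_Schwarz_Re[of "A x" x] by linarith
    also have "\<dots> \<le> (norm x * K) * norm x"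
      by (intro mult_right_mono K) simp
    finally have "sqrt (Re (cinner (A x) x)) \<le> sqrt (K * (norm x)\<^sup>2)"
      by (simp add: power2_eq_square mult_ac)
    then show ?thesis by (simp add: real_sqrt_mult)
  qed
  have "norm (A x) \<le> sqrt K * sqrt (Re (cinner (A x) x))" for x
  proof (cases "A x = 0")
    case False
    have "norm (A x) * norm (A x) = Re (cinner (A x) (A x))"
      by (simp add: cinner_self power2_eq_square)
    also have "\<dots> \<le> sqrt (Re (cinner (A x) x)) * sqrt (Re (cinner (A (A x)) (A x)))"
      using pos_Cauchy_Schwarz[OF A, of x "A x"] by linarith
    also have "\<dots> \<le> sqrt (Re (cinner (A x) x)) * (sqrt K * norm (A x))"
      by (intro mult_left_mono q) (simp add: pos_Re[OF A])
    finally show ?thesis using False by (simp add: mult_ac)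
  qed (simp add: pos_Re[OF A] less_imp_le[OF K(1)])
  then show ?thesis using q K(1) by (intro that[of "sqrt K"]) auto
qed

lemma self_mult_le_cancel:
  fixes s d :: real
  assumes "s * s \<le> d * s" "0 < d" "0 \<le> s"
  shows "s \<le> d"
  using assms by (cases "s = 0") auto

lemma clinear_eqI:
  fixes C D :: "'a::complex_inner \<Rightarrow> 'a"
  assumes C: "bounded_clinear C" and D: "bounded_clinear D"
    and eq: "\<And>x. cinner (C x) x = cinner (D x) x"
  shows "C = D"
proof
  fix x
  have add: "C (x + y) = C x + C y" "D (x + y) = D x + D y" for x y
    using C D by (auto simp: bounded_clinear_def linear_add bounded_linear.linear)
  have sc: "C (c *\<^sub>C x) = c *\<^sub>C C x" "D (c *\<^sub>C x) = c *\<^sub>C D x" for c x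
    using C D by (auto simp: bounded_clinear_def)
  have 1: "cinner (C x) y + cinner (C y) x = cinner (D x) y + cinner (D y) x" for y
    using eq[of "x + y"] eq[of x] eq[of y]
    by (simp add: add cinner_add_left cinner_add_right) (simp add: add.commute)
  have 2: "cinner (C x) y = cinner (D x) y" for y
    using 1[of y] 1[of "\<i> *\<^sub>C y"]
    by (simp add: sc cinner_scaleC_left cinner_scaleC_right complex_eq_iff)
  have "cinner (C x - D x) (C x - D x) = 0"
    using 2 by (simp add: cinner_diff_left)
  then show "C x = D x" by (simp add: cinner_self)
qed

subsection \<open>Existence\<close>

abbreviation op_form :: "('a::complex_inner \<Rightarrow> 'a) \<Rightarrow> 'a \<Rightarrow> real" where
  "op_form A x \<equiv> Re (cinner (A x) x)"

text \<open>\<open>approx A K x z\<close>: the vectors \<open>A (x - y)\<close>, for \<open>y\<close> in \<open>K\<close> nearly minimising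
  \<open>(A (x - y) | x - y)\<close>, come arbitrarily close to \<open>z\<close>.\<close>

definition approx :: "('a::complex_inner \<Rightarrow> 'a) \<Rightarrow> 'a set \<Rightarrow> 'a \<Rightarrow> 'a \<Rightarrow> bool" where
  "approx A K x z \<longleftrightarrow> (\<forall>e>0. \<exists>y\<in>K.
     (\<forall>w\<in>K. \<bar>Re (cinner (A (x - y)) w)\<bar> \<le> e * sqrt (Re (cinner (A w) w))) \<and>
     norm (A (x - y) - z) \<le> e)"

context
  fixes A :: "'a::chilbert_space \<Rightarrow> 'a" and K :: "'a set"
  assumes A: "bounded_positive A"
    and K_0: "0 \<in> K" and K_add: "\<And>x y. x \<in> K \<Longrightarrow> y \<in> K \<Longrightarrow> x + y \<in> K"
    and K_scaleC: "\<And>c x. x \<in> K \<Longrightarrow> c *\<^sub>C x \<in> K"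
begin

lemma K_scaleR: "x \<in> K \<Longrightarrow> r *\<^sub>R x \<in> K"
  by (simp add: scaleR_scaleC K_scaleC)

lemma K_diff: "x \<in> K \<Longrightarrow> y \<in> K \<Longrightarrow> x - y \<in> K"
  using K_add[of x "-1 *\<^sub>R y"] K_scaleR[of y "-1"] by simp

lemma op_form_bdd_below: "bdd_below ((\<lambda>y. op_form A (x - y)) ` K)"
  using pos_Re[OF A] by (intro bdd_belowI2[where m = 0]) auto

lemma approx_add:
  assumes "approx A K x z" "approx A K x' z'"
  shows "approx A K (x + x') (z + z')"
  unfolding approx_def
proof (intro allI impI)
  fix e :: real assume "e > 0"
  then have e: "e / 2 > 0" by simp
  obtain y where y: "y \<in> K" "\<And>w. w \<in> K \<Longrightarrow> \<bar>Re (cinner (A (x - y)) w)\<bar> \<le> e / 2 * sqrt (op_form A w)"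
     "norm (A (x - y) - z) \<le> e / 2"
    using assms(1) e unfolding approx_def by blast
  obtain y' where y': "y' \<in> K"
     "\<And>w. w \<in> K \<Longrightarrow> \<bar>Re (cinner (A (x' - y')) w)\<bar> \<le> e / 2 * sqrt (op_form A w)"
     "norm (A (x' - y') - z') \<le> e / 2"
    using assms(2) e unfolding approx_def by blast
  have eq: "A (x + x' - (y + y')) = A (x - y) + A (x' - y')"
    by (simp add: algebra_simps flip: pos_add[OF A])
  have "\<bar>Re (cinner (A (x + x' - (y + y'))) w)\<bar> \<le> e * sqrt (op_form A w)" if "w \<in> K" for w
    using y(2)[OF that] y'(2)[OF that] unfolding eq by (simp add: cinner_add_left)
  moreover have "norm (A (x + x' - (y + y')) - (z + z')) \<le> e"
    using y(3) y'(3) norm_triangle_ineq[of "A (x - y) - z" "A (x' - y') - z'"]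
    unfolding eq by (simp add: algebra_simps)
  ultimately show "\<exists>y\<in>K. (\<forall>w\<in>K. \<bar>Re (cinner (A (x + x' - y)) w)\<bar> \<le> e * sqrt (op_form A w)) \<and>
     norm (A (x + x' - y) - (z + z')) \<le> e"
    using K_add[OF y(1) y'(1)] by blast
qed

lemma approx_scaleC:
  assumes "approx A K x z"
  shows "approx A K (c *\<^sub>C x) (c *\<^sub>C z)"
  unfolding approx_def
proof (intro allI impI)
  fix e :: real assume "e > 0"
  define d where "d = e / (norm c + 1)"
  have n: "norm c + 1 > 0" by (simp add: add_nonneg_pos)
  have d: "d > 0" using \<open>e > 0\<close> n by (simp add: d_def)
  have le: "norm c * d \<le> e"
    using \<open>e > 0\<close> n by (simp add: d_def field_simps)
  obtain y where y: "y \<in> K" "\<And>w. w \<in> K \<Longrightarrow> \<bar>Re (cinner (A (x - y)) w)\<bar> \<le> d * sqrt (op_form A w)"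
     "norm (A (x - y) - z) \<le> d"
    using assms d unfolding approx_def by blast
  have eq: "A (c *\<^sub>C x - c *\<^sub>C y) = c *\<^sub>C A (x - y)"
    by (simp add: pos_scaleC[OF A] flip: scaleC_diff_right)
  have "\<bar>Re (cinner (A (c *\<^sub>C x - c *\<^sub>C y)) w)\<bar> \<le> e * sqrt (op_form A w)" if "w \<in> K" for w
  proof -
    have "\<bar>Re (cinner (A (c *\<^sub>C x - c *\<^sub>C y)) w)\<bar> = \<bar>Re (cinner (A (x - y)) (cnj c *\<^sub>C w))\<bar>"
      unfolding eq by (simp add: cinner_scaleC_left cinner_scaleC_right)
    also have "\<dots> \<le> d * (norm c * sqrt (op_form A w))"
      using y(2)[OF K_scaleC[OF that], of "cnj c"] by (simp add: pos_seminorm_scaleC[OF A])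
    also have "\<dots> \<le> e * sqrt (op_form A w)"
      using mult_right_mono[OF le, of "sqrt (op_form A w)"] by (simp add: pos_Re[OF A] mult_ac)
    finally show ?thesis .
  qed
  moreover have "norm (A (c *\<^sub>C x - c *\<^sub>C y) - c *\<^sub>C z) \<le> e"
  proof -
    have "norm (A (c *\<^sub>C x - c *\<^sub>C y) - c *\<^sub>C z) = norm c * norm (A (x - y) - z)"
      unfolding eq by (simp add: norm_scaleC flip: scaleC_diff_right)
    also have "\<dots> \<le> norm c * d" by (intro mult_left_mono y) simp
    finally show ?thesis using le by linarith
  qed
  ultimately show "\<exists>y\<in>K. (\<forall>w\<in>K. \<bar>Re (cinner (A (c *\<^sub>C x - y)) w)\<bar> \<le> e * sqrt (op_form A w)) \<and>
     norm (A (c *\<^sub>C x - y) - c *\<^sub>C z) \<le> e"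
    using K_scaleC[OF y(1), of c] by blast
qed

lemma approx_0:
  assumes "approx A K 0 z"
  shows "z = 0"
proof -
  obtain M where M: "0 \<le> M" "\<And>x. norm (A x) \<le> M * sqrt (op_form A x)"
    by (rule pos_norm_bound[OF A]) blast
  have "norm z \<le> e" if "e > 0" for e
  proof -
    define d where "d = e / (M + 1)"
    have d: "d > 0" using that M by (simp add: d_def)
    obtain y where y: "y \<in> K" "\<And>w. w \<in> K \<Longrightarrow> \<bar>Re (cinner (A (0 - y)) w)\<bar> \<le> d * sqrt (op_form A w)"
       "norm (A (0 - y) - z) \<le> d"
      using assms d unfolding approx_def by blast
    have "0 - y \<in> K" using K_diff[OF K_0 y(1)] .
    from y(2)[OF this] have "op_form A (0 - y) \<le> d * sqrt (op_form A (0 - y))"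
      by linarith
    then have "sqrt (op_form A (0 - y)) * sqrt (op_form A (0 - y)) \<le> d * sqrt (op_form A (0 - y))"
      using pos_Re[OF A, of "0 - y"] by simp
    then have "sqrt (op_form A (0 - y)) \<le> d"
      by (rule self_mult_le_cancel) (use d pos_Re[OF A, of "0 - y"] in auto)
    then have "norm (A (0 - y)) \<le> M * d"
      using M(2)[of "0 - y"] mult_left_mono[OF _ M(1)] order_trans by blast
    then have "norm z \<le> M * d + d"
      using y(3) norm_triangle_ineq4[of "A (0 - y)" "A (0 - y) - z"] by simp
    also have "\<dots> = (M + 1) * d" by (simp add: algebra_simps)
    also have "\<dots> = e" using M(1) by (simp add: d_def)
    finally show ?thesis .
  qed
  then have "norm z \<le> 0" by (rule field_le_epsilon) simp
  then show ?thesis by simp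
qed

lemma approx_unique:
  assumes "approx A K x z" "approx A K x z'"
  shows "z = z'"
proof -
  have m: "-1 *\<^sub>C v = - v" for v :: 'a
    using scaleR_scaleC[of "-1" v] by simp
  show ?thesis
    using approx_0[of "z - z'"] approx_add[OF assms(1) approx_scaleC[OF assms(2), of "-1"]]
    by (simp add: m)
qed

lemma approx_exists: "\<exists>z. approx A K x z"
proof -
  obtain M where M: "0 \<le> M" "\<And>x. norm (A x) \<le> M * sqrt (op_form A x)"
    by (rule pos_norm_bound[OF A]) blast
  define m where "m = (INF y\<in>K. op_form A (x - y))"
  define e :: "nat \<Rightarrow> real" where "e n = inverse (real (Suc n))" for n
  have e0: "e n > 0" for n by (simp add: e_def)
  have "\<exists>y\<in>K. op_form A (x - y) < m + (e n)\<^sup>2" for n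
  proof -
    have "m < m + (e n)\<^sup>2" using e0[of n] by simp
    then show ?thesis
      unfolding m_def using op_form_bdd_below K_0 by (subst (asm) cINF_less_iff) auto
  qed
  then obtain y where yK: "\<And>n. y n \<in> K" and ym: "\<And>n. op_form A (x - y n) < m + (e n)\<^sup>2"
    by metis
  have r: "\<bar>Re (cinner (A (x - y n)) w)\<bar> \<le> e n * sqrt (op_form A w)" if "w \<in> K" for n w
  proof -
    have "\<bar>Re (cinner (A (x - y n)) w)\<bar> \<le> sqrt ((e n)\<^sup>2) * sqrt (op_form A w)"
    proof (rule discriminant_bound)
      fix t :: real
      have "m \<le> op_form A (x - (y n + t *\<^sub>R w))"
        unfolding m_def by (rule cINF_lower[OF op_form_bdd_below]) (intro K_add yK K_scaleR that)
      also have "\<dots> = op_form A (x - y n - t *\<^sub>R w)" by (simp add: algebra_simps)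
      also have "\<dots> = op_form A (x - y n) - 2 * t * Re (cinner (A (x - y n)) w) + t\<^sup>2 * op_form A w"
        by (rule pos_expand[OF A])
      finally show "0 \<le> (e n)\<^sup>2 - 2 * t * Re (cinner (A (x - y n)) w) + t\<^sup>2 * op_form A w"
        using ym[of n] by linarith
    qed (rule pos_Re[OF A])
    then show ?thesis using e0[of n] by simp
  qed
  have close: "norm (A (x - y n) - A (x - y k)) \<le> M * (e n + e k)" for n k
  proof -
    define w where "w = y k - y n"
    have w: "w \<in> K" unfolding w_def by (intro K_diff yK)
    have Aw: "A w = A (x - y n) - A (x - y k)"
      by (simp add: w_def flip: pos_diff[OF A])
    have "sqrt (op_form A w) * sqrt (op_form A w) \<le> (e n + e k) * sqrt (op_form A w)"
      using r[OF w, of n] r[OF w, of k] pos_Re[OF A, of w]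
      by (simp add: Aw cinner_diff_left algebra_simps)
    then have "sqrt (op_form A w) \<le> e n + e k"
      by (rule self_mult_le_cancel) (use e0[of n] e0[of k] pos_Re[OF A, of w] in auto)
    then show ?thesis
      using M(2)[of w] mult_left_mono[OF _ M(1)] order_trans unfolding Aw[symmetric] by blast
  qed
  have e_lim: "e \<longlonglongrightarrow> 0"
    unfolding e_def by (rule LIMSEQ_inverse_real_of_nat)
  have small: "\<exists>N. \<forall>n\<ge>N. e n < d" if "d > 0" for d
    using LIMSEQ_D[OF e_lim that] e0 by (simp add: abs_of_pos)
  have "Cauchy (\<lambda>n. A (x - y n))"
  proof (rule CauchyI)
    fix d :: real assume "d > 0"
    then have "d / (2 * (M + 1)) > 0" using M(1) by simp
    from small[OF this] obtain N where N: "\<And>n. n \<ge> N \<Longrightarrow> e n < d / (2 * (M + 1))" by blast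
    have "norm (A (x - y n) - A (x - y k)) < d" if "n \<ge> N" "k \<ge> N" for n k
    proof -
      have "e n + e k < d / (M + 1)"
        using N[OF that(1)] N[OF that(2)] M(1) by (simp add: field_simps)
      then have "(M + 1) * (e n + e k) < d" using M(1) by (simp add: field_simps)
      then show ?thesis using close[of n k] e0[of n] e0[of k] by (simp add: algebra_simps)
    qed
    then show "\<exists>N. \<forall>n\<ge>N. \<forall>k\<ge>N. norm (A (x - y n) - A (x - y k)) < d" by blast
  qed
  then obtain z where z: "(\<lambda>n. A (x - y n)) \<longlonglongrightarrow> z"
    using Cauchy_convergent convergent_def by blast
  have "approx A K x z"
    unfolding approx_def
  proof (intro allI impI)
    fix d :: real assume d: "d > 0"
    obtain N where N: "\<And>n. n \<ge> N \<Longrightarrow> e n < d" using small[OF d] by blast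
    obtain N' where N': "\<And>n. n \<ge> N' \<Longrightarrow> norm (A (x - y n) - z) < d"
      using LIMSEQ_D[OF z d] by blast
    define n where "n = max N N'"
    have "e n < d" "norm (A (x - y n) - z) < d" using N N' by (auto simp: n_def)
    moreover have "\<bar>Re (cinner (A (x - y n)) w)\<bar> \<le> d * sqrt (op_form A w)" if "w \<in> K" for w
      using r[OF that, of n] mult_right_mono[of "e n" d "sqrt (op_form A w)"] \<open>e n < d\<close>
        pos_Re[OF A, of w] by simp
    ultimately show "\<exists>y\<in>K. (\<forall>w\<in>K. \<bar>Re (cinner (A (x - y)) w)\<bar> \<le> d * sqrt (op_form A w)) \<and>
       norm (A (x - y) - z) \<le> d"
      using yK[of n] by (auto intro!: bexI[of _ "y n"])
  qed
  then show ?thesis ..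
qed

lemma approx_near_min:
  assumes "y \<in> K" "e > 0"
    and "\<And>w. w \<in> K \<Longrightarrow> \<bar>Re (cinner (A (x - y)) w)\<bar> \<le> e * sqrt (op_form A w)"
  shows "op_form A (x - y) - e\<^sup>2 \<le> (INF y\<in>K. op_form A (x - y))"
proof (rule cINF_greatest)
  fix y' assume y': "y' \<in> K"
  define w where "w = y' - y"
  have w: "w \<in> K" unfolding w_def by (intro K_diff assms y')
  have "op_form A (x - y') = op_form A (x - y - 1 *\<^sub>R w)" by (simp add: w_def)
  also have "\<dots> = op_form A (x - y) - 2 * Re (cinner (A (x - y)) w) + (sqrt (op_form A w))\<^sup>2"
    by (simp only: pos_expand[OF A]) (simp add: pos_Re[OF A])
  also have "\<dots> \<ge> op_form A (x - y) - 2 * (e * sqrt (op_form A w)) + (sqrt (op_form A w))\<^sup>2"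
    using assms(3)[OF w] by linarith
  finally show "op_form A (x - y) - e\<^sup>2 \<le> op_form A (x - y')"
    using zero_le_power2[of "sqrt (op_form A w) - e"] by (simp add: power2_diff algebra_simps)
qed (use K_0 in auto)

lemma approx_near_min_le: "(INF y\<in>K. op_form A (x - y)) \<le> op_form A x"
  using cINF_lower[OF op_form_bdd_below K_0, of x] by simp

lemma approx_form:
  assumes "approx A K x z"
  shows "cinner z x = complex_of_real (INF y\<in>K. op_form A (x - y))"
proof -
  define m where "m = (INF y\<in>K. op_form A (x - y))"
  define b where "b = 1 + 2 * (2 * sqrt (op_form A x) + 1) + 2 * norm x"
  have b: "b > 0" using pos_Re[OF A, of x] by (simp add: b_def add_pos_nonneg)
  have est: "norm (cinner z x - of_real m) \<le> b * e" if e: "e > 0" "e \<le> 1" for e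
  proof -
    obtain y where y: "y \<in> K" "\<And>w. w \<in> K \<Longrightarrow> \<bar>Re (cinner (A (x - y)) w)\<bar> \<le> e * sqrt (op_form A w)"
       "norm (A (x - y) - z) \<le> e"
      using assms e unfolding approx_def by blast
    define u where "u = x - y"
    have m1: "op_form A u - e\<^sup>2 \<le> m" unfolding m_def u_def by (rule approx_near_min[OF y(1) e(1) y(2)])
    have m2: "m \<le> op_form A u" unfolding m_def u_def by (rule cINF_lower[OF op_form_bdd_below y(1)])
    have e2: "e\<^sup>2 \<le> e" using e by (simp add: power2_eq_square mult_left_le)
    have "op_form A u \<le> op_form A x + e\<^sup>2" using m1 approx_near_min_le[of x] by (simp add: m_def)
    then have "sqrt (op_form A u) \<le> sqrt (op_form A x + e\<^sup>2)" by simp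
    also have "\<dots> \<le> sqrt (op_form A x) + e"
      using sqrt_add_le_add_sqrt[of "op_form A x" "e\<^sup>2"] e pos_Re[OF A, of x] by simp
    finally have qu: "sqrt (op_form A u) \<le> sqrt (op_form A x) + 1" using e by linarith
    have "sqrt (op_form A y) \<le> sqrt (op_form A x) + norm (-1::complex) * sqrt (op_form A u)"
    proof -
      have "(-1) *\<^sub>C u = - u" using scaleR_scaleC[of "-1" u] by simp
      then have "y = x + (-1) *\<^sub>C u" by (simp add: u_def)
      then show ?thesis
        using pos_seminorm_add[OF A, of x "(-1) *\<^sub>C u"] pos_seminorm_scaleC[OF A, of "-1" u]
        by simp
    qed
    then have qy: "sqrt (op_form A y) \<le> 2 * sqrt (op_form A x) + 1" using qu by simp
    have "norm (cinner (A u) y) \<le> 2 * (e * sqrt (op_form A y))"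
      using norm_le_Re_plus[of "cinner (A u) y"] y(2)[OF y(1)] y(2)[OF K_scaleC[OF y(1), of "-\<i>"]]
        pos_seminorm_scaleC[OF A, of "-\<i>" y]
      by (simp add: u_def cinner_scaleC_right)
    also have "\<dots> \<le> 2 * (e * (2 * sqrt (op_form A x) + 1))"
      using mult_left_mono[OF qy, of e] e by simp
    finally have n1: "norm (cinner (A u) y) \<le> 2 * (2 * sqrt (op_form A x) + 1) * e" by (simp add: mult_ac)
    have "norm (cinner (z - A u) x) \<le> 2 * (norm (z - A u) * norm x)" by (rule cinner_bound)
    also have "\<dots> \<le> 2 * (e * norm x)"
      using y(3) by (simp add: u_def norm_minus_commute mult_right_mono)
    finally have n2: "norm (cinner (z - A u) x) \<le> 2 * norm x * e" by (simp add: mult_ac)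
    have "cinner (A u) u - of_real m = of_real (op_form A u - m)"
      using pos_Im[OF A, of u] by (simp add: complex_eq_iff)
    then have "norm (cinner (A u) u - of_real m) = \<bar>op_form A u - m\<bar>"
      by (metis norm_of_real)
    then have n3: "norm (cinner (A u) u - of_real m) \<le> e"
      using m1 m2 e2 by linarith
    have "cinner z x - of_real m
       = cinner (z - A u) x + (cinner (A u) y + (cinner (A u) u - of_real m))"
      by (simp add: u_def cinner_diff_left cinner_diff_right)
    then have "norm (cinner z x - of_real m)
       \<le> norm (cinner (z - A u) x)
         + (norm (cinner (A u) y) + norm (cinner (A u) u - of_real m))"
      by (metis add_left_mono norm_triangle_ineq order_trans)
    also have "\<dots> \<le> b * e" using n1 n2 n3 by (simp add: b_def algebra_simps)
    finally show ?thesis .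
  qed
  have "norm (cinner z x - of_real m) \<le> d" if "d > 0" for d
  proof -
    have "norm (cinner z x - of_real m) \<le> b * min 1 (d / b)"
      using that b by (intro est) auto
    also have "\<dots> \<le> d"
    proof -
      have "b * min 1 (d / b) \<le> b * (d / b)" using b by (intro mult_left_mono) auto
      then show ?thesis using b by simp
    qed
    finally show ?thesis .
  qed
  then have "norm (cinner z x - of_real m) \<le> 0" by (rule field_le_epsilon) simp
  then show ?thesis by (simp add: m_def)
qed

lemma approx_bounded: "\<exists>L. \<forall>x z. approx A K x z \<longrightarrow> norm z \<le> norm x * L"
proof -
  obtain M where M: "0 \<le> M" "\<And>x. norm (A x) \<le> M * sqrt (op_form A x)"
    "\<And>x. sqrt (op_form A x) \<le> M * norm x"
    by (rule pos_norm_bound[OF A]) blast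
  have "norm z \<le> norm x * (M * (M + 1) + 1)" if xz: "approx A K x z" for x z
  proof (cases "x = 0")
    case True
    then show ?thesis using approx_0 xz by simp
  next
    case False
    define e where "e = norm x"
    have e: "e > 0" using False by (simp add: e_def)
    obtain y where y: "y \<in> K" "\<And>w. w \<in> K \<Longrightarrow> \<bar>Re (cinner (A (x - y)) w)\<bar> \<le> e * sqrt (op_form A w)"
       "norm (A (x - y) - z) \<le> e"
      using xz e unfolding approx_def by blast
    define u where "u = x - y"
    have "op_form A u \<le> op_form A x + e\<^sup>2"
      using approx_near_min[OF y(1) e y(2)] approx_near_min_le[of x] by (simp add: u_def)
    then have "sqrt (op_form A u) \<le> sqrt (op_form A x + e\<^sup>2)" by simp
    also have "\<dots> \<le> sqrt (op_form A x) + e"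
      using sqrt_add_le_add_sqrt[of "op_form A x" "e\<^sup>2"] e pos_Re[OF A, of x] by simp
    also have "\<dots> \<le> (M + 1) * norm x" using M(3)[of x] by (simp add: e_def algebra_simps)
    finally have "M * sqrt (op_form A u) \<le> M * ((M + 1) * norm x)" by (rule mult_left_mono) (rule M)
    then have "norm (A u) \<le> M * ((M + 1) * norm x)" using M(2)[of u] by linarith
    then show ?thesis
      using y(3) norm_triangle_ineq4[of "A u" "A u - z"] by (simp add: u_def e_def algebra_simps)
  qed
  then show ?thesis by blast
qed

lemma ex_form_operator:
  "\<exists>C. bounded_positive C \<and> (\<forall>x. cinner (C x) x = complex_of_real (INF y\<in>K. op_form A (x - y)))"
proof -
  obtain C where C: "\<And>x. approx A K x (C x)" using approx_exists by metis
  obtain L where L: "\<And>x z. approx A K x z \<Longrightarrow> norm z \<le> norm x * L"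
    using approx_bounded by blast
  have sc: "C (c *\<^sub>C x) = c *\<^sub>C C x" for c x
    by (rule approx_unique[OF C approx_scaleC[OF C]])
  have "bounded_linear C"
  proof (rule bounded_linear_intro[of C L])
    show "C (x + y) = C x + C y" for x y
      by (rule approx_unique[OF C approx_add[OF C C]])
    show "C (r *\<^sub>R x) = r *\<^sub>R C x" for r x
      by (simp add: scaleR_scaleC sc)
    show "norm (C x) \<le> norm x * L" for x by (rule L[OF C])
  qed
  moreover have "0 \<le> (INF y\<in>K. op_form A (x - y))" for x
    by (rule cINF_greatest) (use K_0 pos_Re[OF A] in auto)
  ultimately have "bounded_positive C"
    unfolding bounded_positive_def bounded_clinear_def
    by (simp add: sc approx_form[OF C] less_eq_complex_def)
  with approx_form[OF C] show ?thesis by blast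
qed

end

lemma ex1_ac_part:
  fixes A B :: "'a::chilbert_space \<Rightarrow> 'a"
  assumes "bounded_positive A" "bounded_positive B"
  shows "\<exists>!C. bounded_positive C \<and>
    (\<forall>x. cinner (C x) x = complex_of_real (ac_quadratic_form A B x))"
proof -
  have "\<exists>C. bounded_positive C \<and>
     (\<forall>x. cinner (C x) x = complex_of_real (ac_quadratic_form A B x))"
    unfolding ac_quadratic_form_def
    by (rule ex_form_operator[OF assms(1)])
      (simp_all add: op_kernel_def pos_zero[OF assms(2)] pos_add[OF assms(2)]
        pos_scaleC[OF assms(2)])
  then show ?thesis
    by (rule ex_ex1I) (auto intro!: clinear_eqI simp: bounded_positive_def)
qed

lemma ac_part:
  fixes A B :: "'a::chilbert_space \<Rightarrow> 'a"
  assumes "bounded_positive A" "bounded_positive B"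
  shows "bounded_positive (ac_part A B)"
    and "cinner (ac_part A B x) x = complex_of_real (ac_quadratic_form A B x)"
  using theI'[OF ex1_ac_part[OF assms]] unfolding ac_part_def by blast+

end

theory Submission
  imports Defs
begin

text \<open>\<open>ac_part A B\<close> is the largest positive operator below \<open>A\<close> that vanishes on \<open>ker B\<close>, and
  the form of \<open>sing_part A B\<close> has infimum \<open>0\<close> on every coset of \<open>ker B\<close>. Hence an operator
  dominated by \<open>B\<close> and lying below \<open>sing_part A B + R\<close>, where \<open>R\<close> vanishes on \<open>ker B\<close>, lies
  below \<open>R\<close>. With \<open>R = 0\<close> this is the singularity of \<open>sing_part A B\<close>.

  If \<open>ac_part A B\<close> is dominated by \<open>B\<close>, maximality forces uniqueness. If it is not, a gliding
  hump argument yields a vector \<open>v\<close> such that \<open>R x = (x | v) v\<close> is below \<open>ac_part A B\<close> but not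
  dominated by \<open>B\<close>. An operator below a multiple of \<open>R\<close> is itself a multiple of \<open>R\<close>, so
  \<open>sing_part A B + R\<close> is still singular to \<open>B\<close>, and \<open>R\<close> can be moved from one part to the
  other.\<close>

section \<open>Positive operators\<close>

text \<open>Both forms are real, and replacing \<open>c\<close> by \<open>max c 0\<close> is
  harmless because the form of \<open>B\<close> is nonnegative.\<close>

lemma dominated_iff_op_form:
  assumes "bounded_positive A" "bounded_positive B"
  shows "dominated A B \<longleftrightarrow> (\<exists>c\<ge>0. \<forall>x. op_form A x \<le> c * op_form B x)"
proof -
  have "op_le A (\<lambda>x. c *\<^sub>R B x) \<longleftrightarrow> (\<forall>x. op_form A x \<le> c * op_form B x)" for c
    by (simp add: op_le_def cinner_scaleR_left less_eq_complex_def assms pos_Im)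
  moreover have "op_form A x \<le> max c 0 * op_form B x" if "op_form A x \<le> c * op_form B x" for c x
    using that mult_right_mono[of c "max c 0" "op_form B x"] pos_Re[OF assms(2), of x] by simp
  ultimately show ?thesis
    unfolding dominated_def by (meson max.cobounded2)
qed

lemma pos_eq_0_if_op_form_0:
  assumes "bounded_positive A" "op_form A x \<le> 0"
  shows "A x = 0"
proof -
  obtain M where "0 \<le> M" "\<And>x. norm (A x) \<le> M * sqrt (op_form A x)"
    by (rule pos_norm_bound[OF assms(1)]) blast
  moreover have "op_form A x = 0" using assms pos_Re[of A x] by simp
  ultimately show ?thesis by (metis mult_zero_right norm_le_zero_iff real_sqrt_zero)
qed

text \<open>By symmetry the cross term of the expansion vanishes together with \<open>A y\<close>.
  Forms that vanish on \<open>op_kernel B\<close> are thus constant on its cosets.\<close>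

lemma op_form_shift:
  assumes "bounded_positive A" "A y = 0"
  shows "op_form A (x - y) = op_form A x"
  using pos_expand[OF assms(1), of x 1 y] pos_sym[OF assms(1), of x y] assms(2) by simp

lemma bounded_positive_add:
  assumes "bounded_positive A" "bounded_positive B"
  shows "bounded_positive (\<lambda>x. A x + B x)"
  using assms unfolding bounded_positive_def bounded_clinear_def
  by (auto simp: scaleC_add_right cinner_add_left bounded_linear_add)

lemma bounded_positive_diff:
  assumes "bounded_positive A" "bounded_positive B" "\<And>x. op_form B x \<le> op_form A x"
  shows "bounded_positive (\<lambda>x. A x - B x)"
  using assms(1,2) unfolding bounded_positive_def bounded_clinear_def
  by (auto simp: scaleC_diff_right cinner_diff_left bounded_linear_sub less_eq_complex_def assms(3))

text \<open>This is the orthogonal projection onto the line of \<open>v\<close>, scaled by the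
  square of \<open>norm v\<close>. The case \<open>v = 0\<close> is allowed and gives the zero
  operator.\<close>

definition rank_one :: "'a::complex_inner \<Rightarrow> 'a \<Rightarrow> 'a" where
  "rank_one v x = cinner x v *\<^sub>C v"

lemma cinner_rank_one: "cinner (rank_one v x) x = complex_of_real ((norm (cinner x v))\<^sup>2)"
  unfolding rank_one_def cinner_scaleC_left complex_norm_square by (metis cinner_commute)

lemma bounded_positive_rank_one: "bounded_positive (rank_one v)"
proof -
  have "norm (rank_one v x) \<le> norm x * (2 * norm v * norm v)" for x
    using mult_right_mono[OF cinner_bound[of x v], of "norm v"]
    by (simp add: rank_one_def norm_scaleC mult_ac)
  then have "bounded_linear (rank_one v)"
    by (intro bounded_linear_intro)
      (simp_all add: rank_one_def cinner_add_left cinner_scaleR_left scaleC_add_left scaleC_scaleC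
        scaleR_scaleC cinner_scaleC_left)
  moreover have "0 \<le> cinner (rank_one v x) x" for x
    by (simp add: cinner_rank_one less_eq_complex_def)
  ultimately show ?thesis
    by (simp add: bounded_positive_def bounded_clinear_def rank_one_def cinner_scaleC_left
        scaleC_scaleC)
qed

text \<open>The hypothesis makes \<open>E\<close> vanish on the orthogonal complement of
  \<open>v\<close>, so its form sees only the component \<open>a *\<^sub>C v\<close> of
  \<open>x\<close>.\<close>

lemma pos_below_rank_one:
  assumes "bounded_positive E" "v \<noteq> 0"
    and "\<And>x. op_form E x \<le> k * op_form (rank_one v) x"
  shows "op_form E x = op_form E v / (norm v)^4 * op_form (rank_one v) x"
proof -
  define a where "a = cinner x v / of_real ((norm v)\<^sup>2)"
  define y where "y = x - a *\<^sub>C v"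
  have "cinner y v = 0"
    using assms(2) by (simp add: y_def a_def cinner_diff_left cinner_scaleC_left cinner_self)
  then have "E y = 0"
    using assms(3)[of y] pos_eq_0_if_op_form_0[OF assms(1)] by (simp add: cinner_rank_one)
  then have "op_form E x = op_form E (a *\<^sub>C v)"
    using op_form_shift[OF assms(1), of y x] by (simp add: y_def)
  also have "\<dots> = (norm a)\<^sup>2 * op_form E v"
    using pos_seminorm_scaleC[OF assms(1), of a v] pos_Re[OF assms(1)]
    by (metis power_mult_distrib real_sqrt_pow2)
  also have "\<dots> = op_form E v / (norm v)^4 * op_form (rank_one v) x"
    by (simp add: a_def cinner_rank_one norm_divide norm_power power_divide flip: power_mult)
  finally show ?thesis .
qed

section \<open>The two parts\<close>

context
  fixes A B :: "'a::chilbert_space \<Rightarrow> 'a"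
  assumes A: "bounded_positive A" and B: "bounded_positive B"
begin

lemma op_form_ac_part: "op_form (ac_part A B) x = (INF y\<in>op_kernel B. op_form A (x - y))"
  by (simp add: ac_part[OF A B] ac_quadratic_form_def)

lemma kernel_nonempty: "0 \<in> op_kernel B"
  by (simp add: op_kernel_def pos_zero[OF B])

lemma ac_part_le_shift: "y \<in> op_kernel B \<Longrightarrow> op_form (ac_part A B) x \<le> op_form A (x - y)"
  unfolding op_form_ac_part
  by (rule cINF_lower) (auto intro!: bdd_belowI2[where m = 0] pos_Re[OF A])

lemma ac_part_le: "op_form (ac_part A B) x \<le> op_form A x"
  using ac_part_le_shift[OF kernel_nonempty, of x] by simp

lemma ac_part_abs_cont: "abs_cont (ac_part A B) B"
  unfolding abs_cont_def
proof
  fix y assume "y \<in> op_kernel B"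
  \<comment> \<open>Shifting \<open>y\<close> by itself leaves the form of \<open>A\<close> at
    0.\<close>
  from ac_part_le_shift[OF this, of y] show "y \<in> op_kernel (ac_part A B)"
    using pos_eq_0_if_op_form_0[OF ac_part(1)[OF A B]] by (simp add: op_kernel_def)
qed

lemma ac_part_greatest:
  assumes C: "bounded_positive C" "abs_cont C B" and le: "\<And>x. op_form C x \<le> op_form A x"
  shows "op_form C x \<le> op_form (ac_part A B) x"
  unfolding op_form_ac_part
proof (rule cINF_greatest)
  fix y assume "y \<in> op_kernel B"
  then have "C y = 0" using C(2) by (auto simp: abs_cont_def op_kernel_def)
  then show "op_form C x \<le> op_form A (x - y)"
    using op_form_shift[OF C(1)] le by metis
qed (use kernel_nonempty in blast)

lemma bounded_positive_sing_part: "bounded_positive (sing_part A B)"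
  unfolding sing_part_def using bounded_positive_diff[OF A ac_part(1)[OF A B] ac_part_le] .

text \<open>\<open>E\<close>, \<open>R\<close> and \<open>ac_part A B\<close> all have forms
  constant on cosets of \<open>op_kernel B\<close>. Shifting \<open>x\<close> to a point where the
  form of \<open>A\<close> nearly attains its infimum makes the form of \<open>sing_part A B\<close>
  small and changes nothing else.\<close>

lemma dominated_below_sing_part_add:
  assumes E: "bounded_positive E" "dominated E B"
    and R: "bounded_positive R" "abs_cont R B"
    and k: "0 \<le> k" "\<And>x. op_form E x \<le> k * (op_form (sing_part A B) x + op_form R x)"
  shows "op_form E x \<le> k * op_form R x"
proof (rule field_le_epsilon)
  let ?D = "ac_part A B"
  fix e :: real assume e: "0 < e"
  \<comment> \<open>The denominator \<open>k + 1\<close> also covers \<open>k = 0\<close>.\<close>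
  define d where "d = e / (k + 1)"
  have d: "d > 0" "k * d \<le> e" using e k(1) by (simp_all add: d_def field_simps)
  have "(INF y\<in>op_kernel B. op_form A (x - y)) < op_form ?D x + d"
    using d by (simp add: op_form_ac_part)
  then obtain y where y: "y \<in> op_kernel B" "op_form A (x - y) < op_form ?D x + d"
    using kernel_nonempty
    by (subst (asm) cINF_less_iff) (auto intro!: bdd_belowI2[where m = 0] pos_Re[OF A])
  from y(1) have "B y = 0" by (simp add: op_kernel_def)
  then have "E y = 0"
    using E(2) pos_eq_0_if_op_form_0[OF E(1), of y] unfolding dominated_iff_op_form[OF E(1) B]
    by (metis cinner_zero_left mult_zero_right zero_complex.sel(1))
  have "?D y = 0" "R y = 0"
    using y(1) ac_part_abs_cont R(2) by (auto simp: abs_cont_def op_kernel_def)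
  note shift = op_form_shift[OF E(1) \<open>E y = 0\<close>, of x] op_form_shift[OF R(1) \<open>R y = 0\<close>, of x]
    op_form_shift[OF ac_part(1)[OF A B] \<open>?D y = 0\<close>, of x]
  have "op_form (sing_part A B) (x - y) + op_form R (x - y) \<le> d + op_form R x"
    using y(2) shift by (simp add: sing_part_def cinner_diff_left)
  then have "k * (op_form (sing_part A B) (x - y) + op_form R (x - y)) \<le> k * (d + op_form R x)"
    using k(1) by (rule mult_left_mono)
  then show "op_form E x \<le> k * op_form R x + e"
    using k(2)[of "x - y"] d(2) shift by (simp add: algebra_simps)
qed

text \<open>The form of such an \<open>E\<close> is a multiple of that of \<open>rank_one v\<close>.
  A nonzero multiple would pass the domination by \<open>B\<close> on to \<open>rank_one v\<close>.
  The alternative \<open>v = 0\<close> yields the singularity of \<open>sing_part A B\<close>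
  itself.\<close>

lemma singular_sing_part_add_rank_one:
  assumes "abs_cont (rank_one v) B" "v = 0 \<or> \<not> dominated (rank_one v) B"
  shows "singular (\<lambda>x. sing_part A B x + rank_one v x) B"
  unfolding singular_def
proof (intro allI impI)
  fix E
  assume E: "bounded_positive E" "dominated E (\<lambda>x. sing_part A B x + rank_one v x)"
    "dominated E B"
  from E(2) obtain k where k: "k \<ge> 0"
    "\<And>x. op_form E x \<le> k * (op_form (sing_part A B) x + op_form (rank_one v) x)"
    by (auto simp: cinner_add_left dominated_iff_op_form[OF E(1)
          bounded_positive_add[OF bounded_positive_sing_part bounded_positive_rank_one]])
  note le = dominated_below_sing_part_add[OF E(1,3) bounded_positive_rank_one assms(1) k]
  show "E = (\<lambda>x. 0)"
  proof (cases "v = 0")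
    case True
    then show ?thesis
      using le pos_eq_0_if_op_form_0[OF E(1)] by (auto simp: cinner_rank_one)
  next
    case False
    note eq = pos_below_rank_one[OF E(1) False le]
    have "op_form E v = 0"
    proof (rule ccontr)
      assume "op_form E v \<noteq> 0"
      then have pos: "op_form E v / (norm v)^4 > 0"
        using pos_Re[OF E(1), of v] False by simp
      from E(3) obtain c where c: "c \<ge> 0" "\<And>x. op_form E x \<le> c * op_form B x"
        by (auto simp: dominated_iff_op_form[OF E(1) B])
      have "op_form (rank_one v) x \<le> c / (op_form E v / (norm v)^4) * op_form B x" for x
        using c(2)[of x] pos unfolding eq[of x] by (subst times_divide_eq_left)
          (simp only: pos_le_divide_eq mult.commute)
      then have "dominated (rank_one v) B"
        unfolding dominated_iff_op_form[OF bounded_positive_rank_one B]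
        using divide_nonneg_pos[OF c(1) pos] by blast
      then show False using assms(2) False by simp
    qed
    then show ?thesis
      using pos_eq_0_if_op_form_0[OF E(1)] eq by (metis div_0 mult_zero_left order_refl)
  qed
qed

lemma lebesgue_decomposition_move_rank_one:
  assumes "\<And>x. op_form (rank_one v) x \<le> op_form (ac_part A B) x"
    and "v = 0 \<or> \<not> dominated (rank_one v) B"
  shows "lebesgue_decomposition A B
    (\<lambda>x. ac_part A B x - rank_one v x) (\<lambda>x. sing_part A B x + rank_one v x)"
proof -
  have zero: "rank_one v y = 0" "ac_part A B y = 0" if "y \<in> op_kernel B" for y
  proof -
    show D: "ac_part A B y = 0"
      using ac_part_abs_cont that by (auto simp: abs_cont_def op_kernel_def)
    show "rank_one v y = 0"
      using assms(1)[of y] D pos_eq_0_if_op_form_0[OF bounded_positive_rank_one] by simp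
  qed
  then have "abs_cont (rank_one v) B" "abs_cont (\<lambda>x. ac_part A B x - rank_one v x) B"
    by (auto simp: abs_cont_def op_kernel_def)
  then show ?thesis
    unfolding lebesgue_decomposition_def
    using bounded_positive_diff[OF ac_part(1)[OF A B] bounded_positive_rank_one assms(1)]
      bounded_positive_add[OF bounded_positive_sing_part bounded_positive_rank_one]
      singular_sing_part_add_rank_one assms(2)
    by (auto simp: sing_part_def)
qed

lemma lebesgue_decomposition_parts:
  "lebesgue_decomposition A B (ac_part A B) (sing_part A B)"
  \<comment> \<open>Moving the zero operator leaves both parts as they are.\<close>
  using lebesgue_decomposition_move_rank_one[of 0] pos_Re[OF ac_part(1)[OF A B]]
  by (simp add: rank_one_def)

lemma lebesgue_decomposition_unique:
  assumes dom: "dominated (ac_part A B) B" and CS: "lebesgue_decomposition A B C S"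
  shows "C = ac_part A B" "S = sing_part A B"
proof -
  let ?D = "ac_part A B"
  have AC: "A = (\<lambda>x. C x + S x)" and C: "bounded_positive C" "abs_cont C B"
    and S: "bounded_positive S" "singular S B"
    using CS by (auto simp: lebesgue_decomposition_def)
  have "op_form C x \<le> op_form A x" for x
    using pos_Re[OF S(1), of x] by (simp add: AC cinner_add_left)
  from ac_part_greatest[OF C this] have CD: "\<And>x. op_form C x \<le> op_form ?D x" .
  let ?E = "\<lambda>x. ?D x - C x"
  have E: "bounded_positive ?E" by (rule bounded_positive_diff[OF ac_part(1)[OF A B] C(1) CD])
  \<comment> \<open>This is \<open>ac_part A B\<close> below \<open>A\<close>, with \<open>A\<close>
    written as \<open>C + S\<close>.\<close>
  have "op_form ?E x \<le> 1 * op_form S x" for x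
    using ac_part_le[of x] by (simp add: AC cinner_diff_left cinner_add_left)
  then have "dominated ?E S"
    unfolding dominated_iff_op_form[OF E S(1)] by (intro exI[of _ 1]) simp
  moreover have "dominated ?E B"
  proof -
    from dom obtain c where c: "c \<ge> 0" "\<And>x. op_form ?D x \<le> c * op_form B x"
      by (auto simp: dominated_iff_op_form[OF ac_part(1)[OF A B] B])
    have "op_form ?E x \<le> c * op_form B x" for x
      using c(2)[of x] pos_Re[OF C(1), of x] by (simp add: cinner_diff_left)
    then show ?thesis unfolding dominated_iff_op_form[OF E B] using c(1) by blast
  qed
  ultimately have "?E = (\<lambda>x. 0)"
    using S(2) E by (auto simp: singular_def)
  then have eq: "?D x = C x" for x by (simp add: fun_eq_iff)
  then show "C = ?D" by auto
  have "A x = C x + S x" for x by (simp add: AC)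
  then show "S = sing_part A B" by (simp add: sing_part_def eq fun_eq_iff)
qed

end

section \<open>The gliding hump\<close>

instance chilbert_space \<subseteq> banach ..

text \<open>\<open>v\<close> is the sum of the terms \<open>D (x n)\<close> with coefficients of
  size \<open>(1/3)^n\<close>, each sign chosen to prevent cancellation with the earlier terms at
  \<open>x n\<close>. The full geometric sum is \<open>3 / 2\<close>; the tail after term
  \<open>n\<close> is at most half of the \<open>n\<close>-th hump.\<close>

lemma signed_sum_hump:
  fixes D :: "'a::chilbert_space \<Rightarrow> 'a"
  assumes D: "bounded_positive D" and x: "\<And>n. op_form D (x n) = 1"
  obtains v where "\<And>y. \<bar>Re (cinner y v)\<bar> \<le> 3 / 2 * sqrt (op_form D y)"
    and "\<And>n. (1/3)^n / 2 \<le> \<bar>Re (cinner (x n) v)\<bar>"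
proof -
  \<comment> \<open>The sign is nonzero even where the real part is 0, so every hump has full
    size.\<close>
  define s where "s n u = (if Re (cinner (x n) u) \<ge> 0 then 1 else -1 :: real)" for n u
  define w where "w = rec_nat 0 (\<lambda>n u. u + (s n u * (1/3)^n) *\<^sub>R D (x n))"
  have w0: "w 0 = 0" and wS: "w (Suc n) = w n + (s n (w n) * (1/3)^n) *\<^sub>R D (x n)" for n
    by (simp_all add: w_def)
  have s: "\<bar>s n u\<bar> = 1" for n u by (simp add: s_def)
  have xD: "Re (cinner (x n) (D (x n))) = 1" for n
    using x[of n] cinner_commute[of "x n" "D (x n)"] by simp
  have Dx: "\<bar>Re (cinner y (D (x n)))\<bar> \<le> sqrt (op_form D y)" for y n
    using pos_Cauchy_Schwarz[OF D, of "x n" y] x[of n] cinner_commute[of y "D (x n)"] by simp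
  have hump: "(1/3)^n \<le> \<bar>Re (cinner (x n) (w (Suc n)))\<bar>" for n
  proof -
    have "Re (cinner (x n) (w (Suc n))) = Re (cinner (x n) (w n)) + s n (w n) * (1/3)^n"
      by (simp add: wS cinner_add_right cinner_scaleR_right xD)
    moreover have "(0::real) \<le> (1/3)^n" by simp
    ultimately show ?thesis by (cases "Re (cinner (x n) (w n)) \<ge> 0") (simp_all add: s_def)
  qed
  \<comment> \<open>The exact value of the finite geometric sum is kept so that the induction
    closes.\<close>
  have diff: "\<bar>Re (cinner y (w (n + m) - w n))\<bar>
      \<le> 3 / 2 * ((1/3)^n - (1/3)^(n + m)) * sqrt (op_form D y)" for y n m
  proof (induction m)
    case (Suc m)
    have "Re (cinner y (w (n + Suc m) - w n)) = Re (cinner y (w (n + m) - w n))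
        + s (n + m) (w (n + m)) * (1/3)^(n + m) * Re (cinner y (D (x (n + m))))"
      by (simp add: wS cinner_add_right cinner_diff_right cinner_scaleR_right)
    moreover have "\<bar>s (n + m) (w (n + m)) * (1/3)^(n + m) * Re (cinner y (D (x (n + m))))\<bar>
        \<le> (1/3)^(n + m) * sqrt (op_form D y)"
      by (simp add: abs_mult s Dx mult_left_mono)
    ultimately have "\<bar>Re (cinner y (w (n + Suc m) - w n))\<bar>
        \<le> 3 / 2 * ((1/3)^n - (1/3)^(n + m)) * sqrt (op_form D y)
          + (1/3)^(n + m) * sqrt (op_form D y)"
      using Suc.IH by linarith
    also have "\<dots> = 3 / 2 * ((1/3)^n - (1/3)^(n + Suc m)) * sqrt (op_form D y)"
      by (simp add: algebra_simps)
    finally show ?case .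
  qed simp
  have bnd: "\<bar>Re (cinner y (w (n + m) - w n))\<bar> \<le> 3 / 2 * (1/3)^n * sqrt (op_form D y)" for y n m
  proof (rule order_trans[OF diff])
    show "3 / 2 * ((1/3)^n - (1/3)^(n + m)) * sqrt (op_form D y)
      \<le> 3 / 2 * (1/3)^n * sqrt (op_form D y)"
      using pos_Re[OF D, of y] by (intro mult_right_mono) auto
  qed
  obtain M where M: "0 \<le> M" "\<And>x. norm (D x) \<le> M * sqrt (op_form D x)"
    by (rule pos_norm_bound[OF D]) blast
  have "summable (\<lambda>n. w (Suc n) - w n)"
  \<comment> \<open>Completeness enters here: the vectors \<open>D (x n)\<close> are bounded by
    \<open>M\<close>, so the series converges in norm.\<close>
  proof (rule summable_comparison_test)
    show "\<exists>N. \<forall>n\<ge>N. norm (w (Suc n) - w n) \<le> (1/3)^n * M"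
      using M(2)[of "x n" for n] x by (auto simp: wS abs_mult s)
    show "summable (\<lambda>n. (1/3)^n * M)" by (intro summable_mult2 summable_geometric) simp
  qed
  then have "convergent (\<lambda>n. w n - w 0)"
    by (simp add: summable_iff_convergent sum_lessThan_telescope)
  then obtain v where v: "w \<longlonglongrightarrow> v" by (auto simp: w0 convergent_def)
  have tail: "\<bar>Re (cinner y (v - w n))\<bar> \<le> 3 / 2 * (1/3)^n * sqrt (op_form D y)" for y n
  proof -
    have "bounded_linear (\<lambda>z. Re (cinner y z))"
    proof (rule bounded_linear_intro)
      show "norm (Re (cinner y z)) \<le> norm z * norm y" for z
        using cinner_Cauchy_Schwarz_Re[of y z] by (simp add: mult.commute)
    qed (simp_all add: cinner_add_right cinner_scaleR_right)
    from bounded_linear.tendsto[OF this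
        tendsto_diff[OF LIMSEQ_ignore_initial_segment[OF v, of n] tendsto_const[of "w n"]]]
    have "(\<lambda>m. Re (cinner y (w (m + n) - w n))) \<longlonglongrightarrow> Re (cinner y (v - w n))" .
    from tendsto_rabs[OF this] show ?thesis
      by (rule LIMSEQ_le_const2) (metis add.commute bnd)
  qed
  show thesis
  proof
    show "\<bar>Re (cinner y v)\<bar> \<le> 3 / 2 * sqrt (op_form D y)" for y
      using tail[of y 0] by (simp add: w0)
    \<comment> \<open>The tail starts at \<open>Suc n\<close>, so that the \<open>n\<close>-th hump
      is already in the partial sum.\<close>
    show "(1/3)^n / 2 \<le> \<bar>Re (cinner (x n) v)\<bar>" for n
      using tail[of "x n" "Suc n"] hump[of n] x[of n]
        abs_triangle_ineq2_sym[of "Re (cinner (x n) (w (Suc n)))" "Re (cinner (x n) v)"]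
      by (simp add: cinner_diff_right)
  qed
qed

lemma ex_rank_one_not_dominated:
  fixes B D :: "'a::chilbert_space \<Rightarrow> 'a"
  assumes B: "bounded_positive B" and D: "bounded_positive D" and "\<not> dominated D B"
  obtains v where "\<And>x. op_form (rank_one v) x \<le> op_form D x" "\<not> dominated (rank_one v) B"
proof -
  \<comment> \<open>The factor \<open>9^n\<close> offsets the squared size of the
    \<open>n\<close>-th hump; the factor \<open>n\<close> then defeats every constant.\<close>
  have "\<exists>x. op_form D x = 1 \<and> real n * 9^n * op_form B x < 1" for n
  proof -
    obtain u where u: "real n * 9^n * op_form B u < op_form D u"
      using assms(3) unfolding dominated_iff_op_form[OF D B]
      by (metis mult_nonneg_nonneg not_less of_nat_0_le_iff zero_le_numeral zero_le_power)
    moreover have "0 \<le> real n * 9^n * op_form B u" using pos_Re[OF B] by simp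
    ultimately have pos: "op_form D u > 0" by linarith
    define x where "x = (1 / sqrt (op_form D u)) *\<^sub>R u"
    have scale: "op_form C x = op_form C u / op_form D u" if "bounded_positive C" for C
      using pos by (simp add: x_def pos_scaleR[OF that] cinner_scaleR_left cinner_scaleR_right
          field_simps)
    show ?thesis
      using pos u by (intro exI[of _ x]) (simp add: scale B D field_simps)
  qed
  then obtain x where x: "\<And>n. op_form D (x n) = 1" "\<And>n. real n * 9^n * op_form B (x n) < 1"
    by metis
  obtain v where v: "\<And>y. \<bar>Re (cinner y v)\<bar> \<le> 3 / 2 * sqrt (op_form D y)"
    "\<And>n. (1/3)^n / 2 \<le> \<bar>Re (cinner (x n) v)\<bar>"
    using signed_sum_hump[of D x, OF D x(1)] by blast
  have norm_v: "norm (cinner y v) \<le> 3 * sqrt (op_form D y)" for y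
    using norm_le_Re_plus[of "cinner y v"] v(1)[of y] v(1)[of "\<i> *\<^sub>C y"]
      pos_seminorm_scaleC[OF D, of \<i> y] by (simp add: cinner_scaleC_left)
  \<comment> \<open>Real and imaginary parts contribute \<open>3 / 2\<close> each to
    \<open>norm_v\<close>; rescaling removes the resulting 3.\<close>
  let ?v = "(1/3) *\<^sub>R v"
  have form_v: "op_form (rank_one ?v) y = (norm (cinner y v))\<^sup>2 / 9" for y
    by (simp add: cinner_rank_one cinner_scaleR_right norm_mult power_mult_distrib power2_eq_square)
  show thesis
  proof
    show "op_form (rank_one ?v) y \<le> op_form D y" for y
      using power_mono[OF norm_v[of y] norm_ge_zero, of 2] pos_Re[OF D, of y]
      by (simp add: form_v power_mult_distrib)
    show "\<not> dominated (rank_one ?v) B"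
    proof
      assume "dominated (rank_one ?v) B"
      then obtain c where c: "c \<ge> 0" "\<And>x. op_form (rank_one ?v) x \<le> c * op_form B x"
        by (auto simp: dominated_iff_op_form[OF bounded_positive_rank_one B])
      \<comment> \<open>Here 36 is 4 times 9: the squared half of the hump and the squared
        rescaling.\<close>
      have le: "real n / 36 \<le> c" for n
      proof -
        have "(1/3)^n / 2 \<le> norm (cinner (x n) v)"
          using v(2)[of n] abs_Re_le_cmod[of "cinner (x n) v"] by linarith
        from power_mono[OF this, of 2] have "(1/9)^n / 4 \<le> (norm (cinner (x n) v))\<^sup>2"
          by (simp add: power_divide power2_eq_square flip: power_mult_distrib)
        also have "\<dots> \<le> 9 * (c * op_form B (x n))"
          using c(2)[of "x n"] by (simp add: form_v)
        finally have "real n * 9^n * ((1/9)^n / 4) \<le> real n * 9^n * (9 * (c * op_form B (x n)))"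
          by (rule mult_left_mono) simp
        also have "\<dots> = 9 * c * (real n * 9^n * op_form B (x n))" by simp
        also have "\<dots> \<le> 9 * c * 1"
          using c(1) x(2)[of n] by (intro mult_left_mono) auto
        finally show ?thesis by (simp add: power_divide)
      qed
      obtain n where "36 * c < real n" using reals_Archimedean2 by blast
      with le[of n] show False by simp
    qed
  qed
qed

theorem theorem2p1:
  fixes A B :: "'a::chilbert_space \<Rightarrow> 'a"
  assumes "bounded_positive A" and "bounded_positive B"
  shows "lebesgue_decomposition A B (ac_part A B) (sing_part A B) \<and>
    ((\<exists>!p. lebesgue_decomposition A B (fst p) (snd p)) \<longleftrightarrow> dominated (ac_part A B) B)"
proof (intro conjI iffI)
  show parts: "lebesgue_decomposition A B (ac_part A B) (sing_part A B)"
    by (rule lebesgue_decomposition_parts[OF assms])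
  show "\<exists>!p. lebesgue_decomposition A B (fst p) (snd p)" if "dominated (ac_part A B) B"
  proof (rule ex1I[of _ "(ac_part A B, sing_part A B)"])
    fix p assume "lebesgue_decomposition A B (fst p) (snd p)"
    from lebesgue_decomposition_unique[OF assms that this]
    show "p = (ac_part A B, sing_part A B)" by (simp add: prod_eq_iff)
  qed (simp add: parts)
  show "dominated (ac_part A B) B" if unique: "\<exists>!p. lebesgue_decomposition A B (fst p) (snd p)"
  proof (rule ccontr)
    assume "\<not> dominated (ac_part A B) B"
    then obtain v where v: "\<And>x. op_form (rank_one v) x \<le> op_form (ac_part A B) x"
      "\<not> dominated (rank_one v) B"
      using ex_rank_one_not_dominated[OF assms(2) ac_part(1)[OF assms]] by blast
    have "lebesgue_decomposition A B
        (\<lambda>x. ac_part A B x - rank_one v x) (\<lambda>x. sing_part A B x + rank_one v x)"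
      using lebesgue_decomposition_move_rank_one[OF assms v(1)] v(2) by blast
    with unique parts have "(ac_part A B, sing_part A B)
        = (\<lambda>x. ac_part A B x - rank_one v x, \<lambda>x. sing_part A B x + rank_one v x)"
      by (metis fst_conv snd_conv)
    \<comment> \<open>So \<open>rank_one v\<close> would be zero, hence dominated by
      \<open>B\<close> with constant 0.\<close>
    then have "sing_part A B x = sing_part A B x + rank_one v x" for x
      by (metis prod.inject)
    then have "op_form (rank_one v) x \<le> 0 * op_form B x" for x
      by simp
    with v(2) show False
      unfolding dominated_iff_op_form[OF bounded_positive_rank_one assms(2)] by blast
  qed
qed

end
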